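(* Let $2\le m\le n$ be integers, let $\mathcal{H}$ be the $m\times n$ half-rectangular grid, and let $P=(x_0,y_0)\in\mathcal{H}$. Then the minimum number of lines in $\mathbb{R}^2$ such that every point of $\mathcal{H}\setminus\{P\}$ lies on at least one of the lines and no line passes through $P$ equals $$n-\left\lceil \frac{n-m}{m-1}\,y_0\right\rceil-1.$$
   Context: For positive integers $m\le n$, the $m\times n$ half-rectangular grid is the set of all integer points $(x,y)\in\mathbb{Z}^2$ with $0\le x\le n-1$, $0\le y\le m-1$ and $(m-1)x+(n-1)y\le (m-1)(n-1)$. *)

theory Defs
  imports "HOL-Analysis.Analysis"
begin

definition half_rect_grid :: "int \<Rightarrow> int \<Rightarrow> (int \<times> int) set" where
  "half_rect_grid m n =
     {(x, y). 0 \<le> x \<and> x \<le> n - 1 \<and> 0 \<le> y \<and> y \<le> m - 1 \<and>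
              (m - 1) * x + (n - 1) * y \<le> (m - 1) * (n - 1)}"

definition real_point :: "int \<times> int \<Rightarrow> real \<times> real" where
  "real_point p = (real_of_int (fst p), real_of_int (snd p))"

definition is_line :: "(real \<times> real) set \<Rightarrow> bool" where
  "is_line l \<longleftrightarrow> affine l \<and> aff_dim l = 1"

definition covers_all_but ::
    "(real \<times> real) set set \<Rightarrow> (int \<times> int) set \<Rightarrow> int \<times> int \<Rightarrow> bool" where
  "covers_all_but L H P \<longleftrightarrow>
     finite L \<and> (\<forall>l\<in>L. is_line l) \<and>
     (\<forall>Q \<in> H - {P}. \<exists>l\<in>L. real_point Q \<in> l) \<and>
     (\<forall>l\<in>L. real_point P \<notin> l)"

text \<open>
  The minimum is attained and is a lower bound; unlike \<open>LEAST\<close> or \<open>Inf\<close>, this asserts existence.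
\<close>

definition is_min_cover_number :: "(int \<times> int) set \<Rightarrow> int \<times> int \<Rightarrow> int \<Rightarrow> bool" where
  "is_min_cover_number H P k \<longleftrightarrow>
     (\<exists>L. covers_all_but L H P \<and> int (card L) = k) \<and>
     (\<forall>L. covers_all_but L H P \<longrightarrow> k \<le> int (card L))"

end

theory Submission
  imports Defs
begin

text \<open>
  The half-rectangular grid is the staircase \<open>{(x, y). 0 \<le> x \<and> 0 \<le> y \<and> x + y \<le> k y}\<close>, where
  \<open>k y = n - \<lceil>(n - m) / (m - 1) * y\<rceil> - 1\<close> is antitone in \<open>y\<close>. For every antitone \<open>k\<close>, the minimum for
  the staircase and the point \<open>P = (x0, y0)\<close> is \<open>k y0\<close>.

  Upper bound: the \<open>y0\<close> horizontal lines below \<open>P\<close>, the \<open>x0\<close> vertical lines to the left of \<open>P\<close>,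
  and the antidiagonals \<open>x + y = c\<close> with \<open>x0 + y0 < c \<le> k y0\<close> cover everything except \<open>P\<close>.

  Lower bound (Alon and Furedi): the staircase contains the product \<open>{0..k y0 - y0} \<times> {0..y0}\<close>. The
  product of the equations of the covering lines vanishes on it except at \<open>P\<close>, so its mixed divided
  difference over this product is nonzero. That divided difference annihilates every polynomial of
  total degree less than \<open>(k y0 - y0) + y0\<close>, hence there are at least \<open>k y0\<close> lines.
\<close>

subsection \<open>Divided differences\<close>

definition divided_difference :: "'a::field set \<Rightarrow> ('a \<Rightarrow> 'a) \<Rightarrow> 'a" where
  "divided_difference A f = (\<Sum>a\<in>A. f a / (\<Prod>b\<in>A - {a}. a - b))"

text \<open>Lagrange interpolation on \<open>A\<close> reproduces \<open>p\<close>; compare the coefficients of degree \<open>card A - 1\<close>.\<close>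

lemma divided_difference_poly:
  fixes p :: "'a::field poly"
  assumes "finite A" "degree p < card A"
  shows "divided_difference A (poly p) = coeff p (card A - 1)"
proof -
  define basis where "basis a = (\<Prod>b\<in>A - {a}. [:- b, 1:])" for a
  define interpolant where
    "interpolant = (\<Sum>a\<in>A. smult (poly p a / (\<Prod>b\<in>A - {a}. a - b)) (basis a))"
  have degree_basis: "degree (basis a) = card A - 1" if "a \<in> A" for a
    using assms(1) that by (simp add: basis_def degree_prod_sum_eq)
  have coeff_basis: "coeff (basis a) (card A - 1) = 1" if "a \<in> A" for a
    using lead_coeff_prod[of "\<lambda>b. [:- b, 1:]" "A - {a}"] degree_basis[OF that]
    by (simp add: basis_def)
  have poly_basis: "poly (basis a) b = (if a = b then \<Prod>c\<in>A - {a}. a - c else 0)"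
    if "a \<in> A" "b \<in> A" for a b
    using assms(1) that by (auto simp: basis_def poly_prod intro!: prod_zero)
  have "p = interpolant"
  proof (rule poly_eqI_degree)
    show "poly p b = poly interpolant b" if "b \<in> A" for b
    proof -
      have "poly interpolant b = (\<Sum>a\<in>A. if a = b then poly p b else 0)"
        unfolding interpolant_def poly_sum using assms(1) that
        by (intro sum.cong) (auto simp: poly_basis)
      then show ?thesis using assms(1) that by simp
    qed
    have "degree interpolant \<le> card A - 1"
      unfolding interpolant_def using assms(1)
      by (intro degree_sum_le) (auto intro: degree_smult_le[THEN order_trans] simp: degree_basis)
    then show "degree interpolant < card A"
      using assms(2) by linarith
  qed (fact assms(2))
  then have "coeff p (card A - 1) = coeff interpolant (card A - 1)"
    by simp
  also have "\<dots> = divided_difference A (poly p)"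
    unfolding interpolant_def divided_difference_def coeff_sum
    by (intro sum.cong) (use coeff_basis in simp_all)
  finally show ?thesis ..
qed

lemma divided_difference_power_eq_0:
  fixes A :: "'a::field set"
  assumes "finite A" "k < card A - 1"
  shows "divided_difference A (\<lambda>x. x ^ k) = 0"
proof -
  have "(\<lambda>x::'a. x ^ k) = poly (monom 1 k)"
    by (simp add: poly_monom fun_eq_iff)
  then show ?thesis
    using assms by (simp add: divided_difference_poly degree_monom_eq)
qed

definition mixed_divided_difference ::
    "'i set \<Rightarrow> ('i \<Rightarrow> 'a::field set) \<Rightarrow> (('i \<Rightarrow> 'a) \<Rightarrow> 'a) \<Rightarrow> 'a" where
  "mixed_divided_difference I A f =
     (\<Sum>x\<in>PiE I A. f x / (\<Prod>i\<in>I. \<Prod>b\<in>A i - {x i}. x i - b))"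

lemma mixed_divided_difference_affine_combination:
  "mixed_divided_difference I A (\<lambda>x. c * f x + (\<Sum>j\<in>J. u j * g j x)) =
     c * mixed_divided_difference I A f + (\<Sum>j\<in>J. u j * mixed_divided_difference I A (g j))"
  unfolding mixed_divided_difference_def
  by (simp add: add_divide_distrib sum_divide_distrib sum.distrib sum_distrib_left sum.swap[of _ J])

lemma mixed_divided_difference_prod:
  assumes "finite I" "\<And>i. i \<in> I \<Longrightarrow> finite (A i)"
  shows "mixed_divided_difference I A (\<lambda>x. \<Prod>i\<in>I. f i (x i)) =
           (\<Prod>i\<in>I. divided_difference (A i) (f i))"
  unfolding mixed_divided_difference_def divided_difference_def
  using assms by (subst prod_sum_PiE) (auto simp: prod_dividef)

lemma mixed_divided_difference_monomial_eq_0: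
  assumes "finite I" "\<And>i. i \<in> I \<Longrightarrow> finite (A i)"
    and degree: "(\<Sum>i\<in>I. s i) < (\<Sum>i\<in>I. card (A i) - 1)"
  shows "mixed_divided_difference I A (\<lambda>x. \<Prod>i\<in>I. x i ^ s i) = 0"
proof -
  obtain i where "i \<in> I" "s i < card (A i) - 1"
    using degree sum_mono[of I "\<lambda>i. card (A i) - 1" s] by (meson not_le)
  then have "divided_difference (A i) (\<lambda>a. a ^ s i) = 0"
    using assms(2) by (intro divided_difference_power_eq_0)
  then show ?thesis
    using assms(1,2) \<open>i \<in> I\<close> by (subst mixed_divided_difference_prod) (auto intro: prod_zero)
qed

lemma mixed_divided_difference_monomial_affine_factors_eq_0:
  assumes "finite I" "\<And>i. i \<in> I \<Longrightarrow> finite (A i)" "finite L"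
    and degree: "(\<Sum>i\<in>I. s i) + card L < (\<Sum>i\<in>I. card (A i) - 1)"
  shows "mixed_divided_difference I A
           (\<lambda>x. (\<Prod>i\<in>I. x i ^ s i) * (\<Prod>l\<in>L. c l + (\<Sum>i\<in>I. u l i * x i))) = 0"
  using assms(3) degree
proof (induction L arbitrary: s rule: finite_induct)
  case empty
  then show ?case
    using assms(1,2) by (simp add: mixed_divided_difference_monomial_eq_0)
next
  case (insert l L)
  define rest where "rest x = (\<Prod>l\<in>L. c l + (\<Sum>i\<in>I. u l i * x i))" for x
  define raise where "raise j = s(j := Suc (s j))" for j
  have degree_raise: "(\<Sum>i\<in>I. raise j i) = Suc (\<Sum>i\<in>I. s i)" if "j \<in> I" for j
    using assms(1) that by (simp add: raise_def sum.remove[of I j])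
  have monomial_raise: "(\<Prod>i\<in>I. x i ^ raise j i) = x j * (\<Prod>i\<in>I. x i ^ s i)" if "j \<in> I" for x j
    using assms(1) that by (simp add: raise_def prod.remove[of I j] mult.assoc)
  have expand: "(\<Prod>i\<in>I. x i ^ s i) * (\<Prod>l\<in>insert l L. c l + (\<Sum>i\<in>I. u l i * x i)) =
      c l * ((\<Prod>i\<in>I. x i ^ s i) * rest x) +
      (\<Sum>j\<in>I. u l j * ((\<Prod>i\<in>I. x i ^ raise j i) * rest x))" for x
    using insert.hyps
    by (simp add: rest_def monomial_raise algebra_simps sum_distrib_left sum_distrib_right)
  have "mixed_divided_difference I A (\<lambda>x. (\<Prod>i\<in>I. x i ^ s i) * rest x) = 0"
    unfolding rest_def using insert.prems insert.hyps by (intro insert.IH) simp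
  moreover have "mixed_divided_difference I A (\<lambda>x. (\<Prod>i\<in>I. x i ^ raise j i) * rest x) = 0"
    if "j \<in> I" for j
    unfolding rest_def using insert.prems insert.hyps that
    by (intro insert.IH) (simp add: degree_raise)
  ultimately show ?case
    by (simp add: expand mixed_divided_difference_affine_combination)
qed

lemma mixed_divided_difference_single:
  assumes "finite I" "\<And>i. i \<in> I \<Longrightarrow> finite (A i)" "p \<in> PiE I A"
    and "\<And>x. x \<in> PiE I A \<Longrightarrow> x \<noteq> p \<Longrightarrow> f x = 0"
  shows "mixed_divided_difference I A f = f p / (\<Prod>i\<in>I. \<Prod>b\<in>A i - {p i}. p i - b)"
  using assms unfolding mixed_divided_difference_def
  by (subst sum.remove[of _ p]) (auto intro: finite_PiE)

subsection \<open>Hyperplanes covering all but one point of a product grid\<close>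

lemma card_affine_functions_vanishing_except_ge:
  fixes p :: "'i \<Rightarrow> 'a::field"
  assumes "finite I" "\<And>i. i \<in> I \<Longrightarrow> finite (A i)" "finite L" "p \<in> PiE I A"
    and nonzero: "\<And>l. l \<in> L \<Longrightarrow> c l + (\<Sum>i\<in>I. u l i * p i) \<noteq> 0"
    and zero: "\<And>x. x \<in> PiE I A \<Longrightarrow> x \<noteq> p \<Longrightarrow> \<exists>l\<in>L. c l + (\<Sum>i\<in>I. u l i * x i) = 0"
  shows "(\<Sum>i\<in>I. card (A i) - 1) \<le> card L"
proof (rule ccontr)
  define f where "f x = (\<Prod>l\<in>L. c l + (\<Sum>i\<in>I. u l i * x i))" for x
  assume "\<not> (\<Sum>i\<in>I. card (A i) - 1) \<le> card L"
  then have "mixed_divided_difference I A f = 0"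
    using mixed_divided_difference_monomial_affine_factors_eq_0[where s = "\<lambda>_. 0", OF assms(1-3)]
    by (simp add: f_def[abs_def])
  moreover have "mixed_divided_difference I A f = f p / (\<Prod>i\<in>I. \<Prod>b\<in>A i - {p i}. p i - b)"
    using assms(3) zero by (intro mixed_divided_difference_single assms(1,2,4)) (auto simp: f_def)
  moreover have "f p \<noteq> 0"
    using assms(3) nonzero by (simp add: f_def)
  moreover have "(\<Prod>i\<in>I. \<Prod>b\<in>A i - {p i}. p i - b) \<noteq> 0"
    using assms(1,2) by simp
  ultimately show False
    by simp
qed

lemma card_hyperplanes_cover_grid_except_ge:
  fixes p :: "'a::euclidean_space"
  assumes "finite L" and hyperplane: "\<And>h. h \<in> L \<Longrightarrow> \<exists>u b. h = {x. u \<bullet> x = b}"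
    and "\<And>i. i \<in> Basis \<Longrightarrow> finite (A i)"
    and p: "\<And>i. i \<in> Basis \<Longrightarrow> p \<bullet> i \<in> A i" "p \<notin> \<Union>L"
    and cover: "{x. \<forall>i\<in>Basis. x \<bullet> i \<in> A i} - {p} \<subseteq> \<Union>L"
  shows "(\<Sum>i\<in>Basis. card (A i) - 1) \<le> card L"
proof -
  obtain u b where hyperplane_eq: "\<And>h. h \<in> L \<Longrightarrow> h = {x. u h \<bullet> x = b h}"
    using hyperplane by metis
  define point :: "('a \<Rightarrow> real) \<Rightarrow> 'a" where "point x = (\<Sum>i\<in>Basis. x i *\<^sub>R i)" for x
  have in_hyperplane_iff: "- b h + (\<Sum>i\<in>Basis. (u h \<bullet> i) * x i) = 0 \<longleftrightarrow> point x \<in> h"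
    if "h \<in> L" for h x
    by (subst (2) hyperplane_eq[OF that]) (auto simp: point_def inner_sum_right mult.commute)
  define coords where "coords = restrict (\<lambda>i. p \<bullet> i) Basis"
  have coords_in: "coords \<in> PiE Basis A"
    using p(1) by (simp add: coords_def)
  have point_coords: "point coords = p"
    by (simp add: point_def coords_def euclidean_representation)
  show ?thesis
  proof (rule card_affine_functions_vanishing_except_ge)
    show "- b h + (\<Sum>i\<in>Basis. (u h \<bullet> i) * coords i) \<noteq> 0" if "h \<in> L" for h
      using p(2) that unfolding in_hyperplane_iff[OF that] point_coords by blast
    show "\<exists>h\<in>L. - b h + (\<Sum>i\<in>Basis. (u h \<bullet> i) * x i) = 0"
      if x: "x \<in> PiE Basis A" "x \<noteq> coords" for x
    proof -
      have point_inner: "point x \<bullet> i = x i" if "i \<in> Basis" for i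
        using that by (simp add: point_def)
      then have "point x \<noteq> p"
        using PiE_ext[OF x(1) coords_in] x(2) by (auto simp: coords_def)
      moreover have "\<forall>i\<in>Basis. point x \<bullet> i \<in> A i"
        using x(1) by (auto simp: point_inner)
      ultimately obtain h where "h \<in> L" "point x \<in> h"
        using cover by auto
      then show ?thesis
        using in_hyperplane_iff by blast
    qed
  qed (use assms(1,3) coords_in in auto)
qed

subsection \<open>Lines covering all but one point of a staircase\<close>

lemma is_line_iff_hyperplane: "is_line l \<longleftrightarrow> (\<exists>u b. u \<noteq> 0 \<and> l = {z. u \<bullet> z = b})"
proof
  assume "is_line l"
  then have "affine hull l = l" "aff_dim l = 1"
    by (simp_all add: is_line_def affine_hull_eq)
  then show "\<exists>u b. u \<noteq> 0 \<and> l = {z. u \<bullet> z = b}"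
    using aff_dim_eq_hyperplane[of l] by (simp del: affine_hull_eq)
qed (auto simp: is_line_def affine_hyperplane aff_dim_hyperplane)

lemma covers_all_but_product_card_ge:
  assumes cover: "covers_all_but L H P"
    and "finite X" "finite Y" "P \<in> X \<times> Y" "X \<times> Y \<subseteq> H"
  shows "(card X - 1) + (card Y - 1) \<le> card L"
proof -
  define A where "A i = real_of_int ` (if i = (1, 0) then X else Y)" for i :: "real \<times> real"
  have A_axes: "A (1, 0) = real_of_int ` X" "A (0, 1) = real_of_int ` Y"
    by (simp_all add: A_def)
  have Basis_plane: "(Basis :: (real \<times> real) set) = {(1, 0), (0, 1)}"
    by (auto simp: Basis_prod_def)
  have "(\<Sum>i\<in>Basis. card (A i) - 1) \<le> card L"
  proof (rule card_hyperplanes_cover_grid_except_ge)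
    show "finite L" "real_point P \<notin> \<Union>L"
      using cover by (auto simp: covers_all_but_def)
    show "\<exists>u b. h = {z. u \<bullet> z = b}" if "h \<in> L" for h
    proof -
      have "is_line h"
        using cover that by (simp add: covers_all_but_def)
      then show ?thesis
        unfolding is_line_iff_hyperplane by blast
    qed
    show "finite (A i)" for i
      using assms(2,3) by (simp add: A_def)
    show "real_point P \<bullet> i \<in> A i" if "i \<in> Basis" for i
      using that assms(4) by (auto simp: Basis_plane A_axes real_point_def)
    show "{z. \<forall>i\<in>Basis. z \<bullet> i \<in> A i} - {real_point P} \<subseteq> \<Union>L"
    proof
      fix z assume z: "z \<in> {z. \<forall>i\<in>Basis. z \<bullet> i \<in> A i} - {real_point P}"
      then have "fst z \<in> real_of_int ` X" "snd z \<in> real_of_int ` Y"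
        by (auto simp: Basis_plane A_axes inner_prod_def)
      then obtain x y where "x \<in> X" "y \<in> Y" "z = real_point (x, y)"
        by (auto simp: real_point_def prod_eq_iff)
      then show "z \<in> \<Union>L"
        using z cover assms(5) by (auto simp: covers_all_but_def)
    qed
  qed
  moreover have "(\<Sum>i\<in>Basis. card (A i) - 1) = (card X - 1) + (card Y - 1)"
    by (simp add: Basis_plane A_axes card_image inj_on_def)
  ultimately show ?thesis
    by simp
qed

definition int_line :: "int \<Rightarrow> int \<Rightarrow> int \<Rightarrow> (real \<times> real) set" where
  "int_line p q c = {z. real_point (p, q) \<bullet> z = real_of_int c}"

lemma is_line_int_line: "(p, q) \<noteq> (0, 0) \<Longrightarrow> is_line (int_line p q c)"
  unfolding is_line_iff_hyperplane int_line_def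
  by (intro exI[of _ "real_point (p, q)"] exI) (auto simp: real_point_def zero_prod_def)

lemma real_point_in_int_line_iff: "real_point (x, y) \<in> int_line p q c \<longleftrightarrow> p * x + q * y = c"
  by (simp add: int_line_def real_point_def flip: of_int_mult of_int_add)

definition axis_diagonal_lines :: "int \<Rightarrow> int \<Rightarrow> int \<Rightarrow> (real \<times> real) set set" where
  "axis_diagonal_lines x0 y0 k =
     int_line 0 1 ` {0..<y0} \<union> int_line 1 0 ` {0..<x0} \<union> int_line 1 1 ` {x0 + y0<..k}"

lemma card_axis_diagonal_lines_le:
  assumes "0 \<le> x0" "0 \<le> y0" "x0 + y0 \<le> k"
  shows "int (card (axis_diagonal_lines x0 y0 k)) \<le> k"
proof -
  have "card (axis_diagonal_lines x0 y0 k) \<le> card {0..<y0} + card {0..<x0} + card {x0 + y0<..k}"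
    unfolding axis_diagonal_lines_def
    by (intro card_Un_le[THEN order_trans] add_mono card_image_le) auto
  then show ?thesis using assms by simp
qed

lemma real_point_in_Union_axis_diagonal_lines_iff:
  "real_point (x, y) \<in> \<Union>(axis_diagonal_lines x0 y0 k) \<longleftrightarrow>
     y \<in> {0..<y0} \<or> x \<in> {0..<x0} \<or> x + y \<in> {x0 + y0<..k}"
  by (auto simp: axis_diagonal_lines_def real_point_in_int_line_iff)

lemma covers_all_but_axis_diagonal_lines:
  assumes "\<And>x y. (x, y) \<in> H \<Longrightarrow> 0 \<le> x \<and> 0 \<le> y \<and> (y0 \<le> y \<longrightarrow> x + y \<le> k)"
  shows "covers_all_but (axis_diagonal_lines x0 y0 k) H (x0, y0)"
  unfolding covers_all_but_def
proof (intro conjI)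
  show "finite (axis_diagonal_lines x0 y0 k)"
    by (simp add: axis_diagonal_lines_def)
  show "\<forall>l\<in>axis_diagonal_lines x0 y0 k. is_line l"
    by (auto simp: axis_diagonal_lines_def is_line_int_line)
  have "real_point (x, y) \<in> \<Union>(axis_diagonal_lines x0 y0 k)"
    if "(x, y) \<in> H" "(x, y) \<noteq> (x0, y0)" for x y
    unfolding real_point_in_Union_axis_diagonal_lines_iff using assms[of x y] that by auto
  then show "\<forall>Q\<in>H - {(x0, y0)}. \<exists>l\<in>axis_diagonal_lines x0 y0 k. real_point Q \<in> l"
    by auto
  have "real_point (x0, y0) \<notin> \<Union>(axis_diagonal_lines x0 y0 k)"
    unfolding real_point_in_Union_axis_diagonal_lines_iff by simp
  then show "\<forall>l\<in>axis_diagonal_lines x0 y0 k. real_point (x0, y0) \<notin> l"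
    by blast
qed

definition staircase :: "(int \<Rightarrow> int) \<Rightarrow> (int \<times> int) set" where
  "staircase k = {(x, y). 0 \<le> x \<and> 0 \<le> y \<and> x + y \<le> k y}"

theorem is_min_cover_number_staircase:
  assumes "antimono k" and P: "(x0, y0) \<in> staircase k"
  shows "is_min_cover_number (staircase k) (x0, y0) (k y0)"
proof -
  have lower: "k y0 \<le> int (card L)" if "covers_all_but L (staircase k) (x0, y0)" for L
  proof -
    have "{0..k y0 - y0} \<times> {0..y0} \<subseteq> staircase k"
      using antimonoD[OF \<open>antimono k\<close>] by (fastforce simp: staircase_def)
    then have "(card {0..k y0 - y0} - 1) + (card {0..y0} - 1) \<le> card L"
      using P by (intro covers_all_but_product_card_ge[OF that]) (auto simp: staircase_def)
    then show ?thesis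
      using P by (simp add: staircase_def)
  qed
  have cover: "covers_all_but (axis_diagonal_lines x0 y0 (k y0)) (staircase k) (x0, y0)"
    using antimonoD[OF \<open>antimono k\<close>]
    by (intro covers_all_but_axis_diagonal_lines) (fastforce simp: staircase_def)
  moreover have "int (card (axis_diagonal_lines x0 y0 (k y0))) = k y0"
    using lower[OF cover] card_axis_diagonal_lines_le[of x0 y0 "k y0"] P
    by (simp add: staircase_def)
  ultimately show ?thesis
    using lower unfolding is_min_cover_number_def by blast
qed

subsection \<open>The half-rectangular grid as a staircase\<close>

definition antidiagonal_bound :: "int \<Rightarrow> int \<Rightarrow> int \<Rightarrow> int" where
  "antidiagonal_bound m n y = n - \<lceil>real_of_int (n - m) / real_of_int (m - 1) * real_of_int y\<rceil> - 1"

lemma antimono_antidiagonal_bound: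
  assumes "1 \<le> m" "m \<le> n"
  shows "antimono (antidiagonal_bound m n)"
  unfolding antidiagonal_bound_def using assms
  by (intro antimonoI diff_mono ceiling_mono mult_left_mono) auto

lemma le_antidiagonal_bound_iff:
  assumes "2 \<le> m"
  shows "z \<le> antidiagonal_bound m n y \<longleftrightarrow> (m - 1) * z + (n - m) * y \<le> (m - 1) * (n - 1)"
proof -
  have "z \<le> antidiagonal_bound m n y \<longleftrightarrow>
      \<lceil>real_of_int (n - m) / real_of_int (m - 1) * real_of_int y\<rceil> \<le> n - 1 - z"
    by (auto simp: antidiagonal_bound_def)
  also have "\<dots> \<longleftrightarrow>
      real_of_int (n - m) * real_of_int y \<le> real_of_int (n - 1 - z) * real_of_int (m - 1)"
    using assms by (simp add: ceiling_le_iff pos_divide_le_eq)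
  also have "\<dots> \<longleftrightarrow> (n - m) * y \<le> (n - 1 - z) * (m - 1)"
    by (simp only: of_int_mult[symmetric] of_int_le_iff)
  also have "\<dots> \<longleftrightarrow> (m - 1) * z + (n - m) * y \<le> (m - 1) * (n - 1)"
    by (auto simp: algebra_simps)
  finally show ?thesis .
qed

lemma half_rect_grid_eq_staircase:
  assumes "2 \<le> m" "m \<le> n"
  shows "half_rect_grid m n = staircase (antidiagonal_bound m n)"
proof -
  have below: "x + y \<le> antidiagonal_bound m n y \<longleftrightarrow>
      (m - 1) * x + (n - 1) * y \<le> (m - 1) * (n - 1)" for x y
    using assms(1) by (simp add: le_antidiagonal_bound_iff algebra_simps)
  have bounds: "x \<le> n - 1 \<and> y \<le> m - 1"
    if "0 \<le> x" "0 \<le> y" "(m - 1) * x + (n - 1) * y \<le> (m - 1) * (n - 1)" for x y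
  proof -
    have "0 \<le> (m - 1) * x" "0 \<le> (n - 1) * y"
      using assms that by simp_all
    then have "(m - 1) * x \<le> (m - 1) * (n - 1)" "(n - 1) * y \<le> (n - 1) * (m - 1)"
      using that(3) by (simp_all add: mult.commute)
    then show ?thesis
      using assms by simp
  qed
  show ?thesis
    using bounds by (auto simp: half_rect_grid_def staircase_def below)
qed

theorem theorem1p3:
  fixes m n x0 y0 :: int
  assumes "2 \<le> m" and "m \<le> n"
    and "(x0, y0) \<in> half_rect_grid m n"
  shows "is_min_cover_number (half_rect_grid m n) (x0, y0)
           (n - \<lceil>real_of_int (n - m) / real_of_int (m - 1) * real_of_int y0\<rceil> - 1)"
proof -
  have grid: "half_rect_grid m n = staircase (antidiagonal_bound m n)"
    using assms(1,2) by (rule half_rect_grid_eq_staircase)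
  have "antimono (antidiagonal_bound m n)"
    using assms(1,2) by (intro antimono_antidiagonal_bound) auto
  then have "is_min_cover_number (half_rect_grid m n) (x0, y0) (antidiagonal_bound m n y0)"
    using assms(3) unfolding grid by (rule is_min_cover_number_staircase)
  then show ?thesis
    unfolding antidiagonal_bound_def .
qed

end
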